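(* Let $k>d\geq1$ and let $\tau=\tau'\mbox{-}(d+1)(d+2)\cdots k$ be a generalized pattern, where $\tau'$ is a generalized pattern on the letters $\{1,\dots,d\}$ and the block $(d+1)(d+2)\cdots k$ has no internal dashes. Then $$F_\tau(x)=\sum_{j=0}^{k-d-1}\bigl(xF_\tau(x)\bigr)^j+x^{k-d}F_\tau^{k-d}(x)F_{\tau'}(x).$$
   Context: A generalized pattern is a permutation of a set of letters written as a word $\tau_1\cdots\tau_k$ in which each pair of adjacent letters may or may not be separated by a dash "-". A permutation $\pi=\pi_1\cdots\pi_n\in S_n$ contains $\tau$ if there are indices $i_1<\dots<i_k$ with $(\pi_{i_1},\dots,\pi_{i_k})$ order-isomorphic to $(\tau_1,\dots,\tau_k)$ and $i_{j+1}=i_j+1$ whenever $\tau_j,\tau_{j+1}$ are not separated by a dash; otherwise $\pi$ avoids $\tau$. Thus $1\mbox{-}3\mbox{-}2$ is the classical pattern $132$. $F_\tau(x)=\sum_{n\geq0}f_\tau(n)x^n$, where $f_\tau(n)$ is the number of permutations in $S_n$ ($S_0$ = the empty permutation) avoiding both $1\mbox{-}3\mbox{-}2$ and $\tau$. *)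

theory Defs
  imports "HOL-Combinatorics.Multiset_Permutations"
    "HOL-Computational_Algebra.Formal_Power_Series"
begin

text \<open>
  A generalized pattern is a word together with the set of places of its dashes:
  \<open>j \<in> dashes \<tau>\<close> means that there is a dash between the \<open>j\<close>-th and the \<open>(j + 1)\<close>-st letter,
  counting letters from 1. In the 0-based list indexing, these are the letters with
  indices \<open>j - 1\<close> and \<open>j\<close>.
\<close>

datatype pattern = Pattern (letters: "nat list") (dashes: "nat set")

definition gen_pattern_on :: "nat set \<Rightarrow> pattern \<Rightarrow> bool" where
  "gen_pattern_on A \<tau> \<longleftrightarrow>
     letters \<tau> \<in> permutations_of_set A \<and> dashes \<tau> \<subseteq> {1..<length (letters \<tau>)}"

definition dash_append :: "pattern \<Rightarrow> pattern \<Rightarrow> pattern" where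
  "dash_append \<sigma> \<tau> =
     Pattern (letters \<sigma> @ letters \<tau>)
       (dashes \<sigma> \<union> {length (letters \<sigma>)} \<union> (\<lambda>j. length (letters \<sigma>) + j) ` dashes \<tau>)"

definition contains :: "nat list \<Rightarrow> pattern \<Rightarrow> bool" where
  "contains \<pi> \<tau> \<longleftrightarrow>
     (\<exists>i :: nat \<Rightarrow> nat.
        strict_mono_on {..<length (letters \<tau>)} i \<and>
        (\<forall>j < length (letters \<tau>). i j < length \<pi>) \<and>
        (\<forall>a < length (letters \<tau>). \<forall>b < length (letters \<tau>).
           \<pi> ! i a < \<pi> ! i b \<longleftrightarrow> letters \<tau> ! a < letters \<tau> ! b) \<and>
        (\<forall>j. Suc j < length (letters \<tau>) \<and> Suc j \<notin> dashes \<tau> \<longrightarrow> i (Suc j) = Suc (i j)))"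

abbreviation avoids :: "nat list \<Rightarrow> pattern \<Rightarrow> bool" where
  "avoids \<pi> \<tau> \<equiv> \<not> contains \<pi> \<tau>"

definition pattern_1_3_2 :: pattern where
  "pattern_1_3_2 = Pattern [1, 3, 2] {1, 2}"

definition avoid_count :: "pattern \<Rightarrow> nat \<Rightarrow> nat" where
  "avoid_count \<tau> n =
     card {\<pi> \<in> permutations_of_set {1..n}. avoids \<pi> pattern_1_3_2 \<and> avoids \<pi> \<tau>}"

definition avoid_gf :: "pattern \<Rightarrow> int fps" where
  "avoid_gf \<tau> = Abs_fps (\<lambda>n. int (avoid_count \<tau> n))"

end

theory Submission
  imports Defs
begin

text \<open>
  Put \<open>m = k - d\<close> and let \<open>G\<^sub>i\<close> count the permutations \<open>\<pi>\<close> avoiding 1-3-2 for which \<open>\<pi>\<close> followed by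
  \<open>i\<close> new increasing maxima avoids \<open>\<tau>\<close>. Then \<open>G\<^sub>0 = F\<^sub>\<tau>\<close> and \<open>G\<^sub>m = F\<^sub>\<tau>\<^sub>'\<close>. A nonempty permutation
  avoiding 1-3-2 is \<open>U D l\<close> with \<open>U > l > D\<close>, where \<open>l\<close> is its last letter. An ascending run never
  crosses from \<open>U\<close> to \<open>D l\<close>, and for \<open>i < m\<close> the final block of an occurrence of \<open>\<tau>\<close> in \<open>U D l\<close> followed by
  \<open>i\<close> maxima starts in \<open>U\<close> or in \<open>D l\<close>. In the first case the occurrence lies in \<open>U\<close>, in the
  second it lies in \<open>D\<close> followed by \<open>i + 1\<close> maxima. Hence \<open>G\<^sub>i = 1 + x F\<^sub>\<tau> G\<^bsub>i+1\<^esub>\<close> for \<open>i < m\<close>,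
  and iteration gives the theorem.
\<close>

section \<open>Containment under concatenation and order-preserving relabelling\<close>

lemma contains_appendI:
  assumes "contains ys \<tau>"
  shows "contains (xs @ ys @ zs) \<tau>"
proof -
  obtain i where i: "strict_mono_on {..<length (letters \<tau>)} i"
    "\<forall>j < length (letters \<tau>). i j < length ys"
    "\<forall>a < length (letters \<tau>). \<forall>b < length (letters \<tau>).
           ys ! i a < ys ! i b \<longleftrightarrow> letters \<tau> ! a < letters \<tau> ! b"
    "\<forall>j. Suc j < length (letters \<tau>) \<and> Suc j \<notin> dashes \<tau> \<longrightarrow> i (Suc j) = Suc (i j)"
    using assms unfolding contains_def by blast
  have nth: "(xs @ ys @ zs) ! (length xs + i j) = ys ! i j" if "j < length (letters \<tau>)" for j
    using i(2) that by (simp add: nth_append)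
  show ?thesis
    unfolding contains_def
  proof (intro exI[of _ "\<lambda>j. length xs + i j"] conjI)
    show "strict_mono_on {..<length (letters \<tau>)} (\<lambda>j. length xs + i j)"
      using i(1) by (auto simp: strict_mono_on_def)
    show "\<forall>j<length (letters \<tau>). length xs + i j < length (xs @ ys @ zs)"
      using i(2) by (auto simp: trans_less_add1)
    show "\<forall>a<length (letters \<tau>). \<forall>b<length (letters \<tau>).
       ((xs @ ys @ zs) ! (length xs + i a) < (xs @ ys @ zs) ! (length xs + i b)) =
       (letters \<tau> ! a < letters \<tau> ! b)"
      using i(3) nth by simp
  qed (use i(4) in auto)
qed

text \<open>Occurrences see positions and the relative order of entries only. This allows blocks of
  values to be shifted, or gaps between values to be opened, without changing containment.\<close>

lemma contains_map_iff:
  assumes "strict_mono_on (set xs) f"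
  shows "contains (map f xs) \<tau> \<longleftrightarrow> contains xs \<tau>"
proof -
  have mono: "f (xs ! p) < f (xs ! q) \<longleftrightarrow> xs ! p < xs ! q" if "p < length xs" "q < length xs" for p q
    using strict_mono_on_less[OF assms] that by simp
  show ?thesis
    unfolding contains_def using mono by (intro ex_cong1) auto
qed

section \<open>Permutations avoiding 1-3-2, split at their last letter\<close>

lemma contains_132_iff:
  "contains \<pi> pattern_1_3_2 \<longleftrightarrow>
     (\<exists>a b c. a < b \<and> b < c \<and> c < length \<pi> \<and> \<pi> ! a < \<pi> ! c \<and> \<pi> ! c < \<pi> ! b)"
proof
  assume "contains \<pi> pattern_1_3_2"
  then obtain i where i: "strict_mono_on {..<3} i" "\<forall>j<3. i j < length \<pi>"
    "\<forall>a<3. \<forall>b<3. \<pi> ! i a < \<pi> ! i b \<longleftrightarrow> [1, 3, 2 :: nat] ! a < [1, 3, 2] ! b"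
    by (auto simp: contains_def pattern_1_3_2_def numeral_3_eq_3)
  have "i 0 < i 1" "i 1 < i 2"
    using i(1) by (auto simp: strict_mono_on_def)
  moreover have "i 2 < length \<pi>"
    using i(2) by simp
  moreover have "\<pi> ! i 0 < \<pi> ! i 2" "\<pi> ! i 2 < \<pi> ! i 1"
    using i(3)[rule_format, of 0 2] i(3)[rule_format, of 2 1] by auto
  ultimately show "\<exists>a b c. a < b \<and> b < c \<and> c < length \<pi> \<and> \<pi> ! a < \<pi> ! c \<and> \<pi> ! c < \<pi> ! b"
    by blast
next
  assume "\<exists>a b c. a < b \<and> b < c \<and> c < length \<pi> \<and> \<pi> ! a < \<pi> ! c \<and> \<pi> ! c < \<pi> ! b"
  then obtain a b c where "a < b" "b < c" "c < length \<pi>" "\<pi> ! a < \<pi> ! c" "\<pi> ! c < \<pi> ! b"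
    by blast
  then show "contains \<pi> pattern_1_3_2"
    unfolding contains_def pattern_1_3_2_def
    by (intro exI[of _ "\<lambda>j. [a, b, c] ! j"])
      (auto simp: strict_mono_on_def less_Suc_eq numeral_3_eq_3)
qed

text \<open>If the "2" of an occurrence lies in \<open>D @ [l]\<close>, its smaller "1" cannot lie
  in \<open>U\<close>, so no occurrence straddles the two parts. Inside \<open>D @ [l]\<close> the
  final \<open>l\<close> could only be the "2", and then the "3" would have to exceed
  \<open>l\<close>, which no entry of \<open>D\<close> does.\<close>

lemma avoids_132_append_iff:
  assumes "\<And>u. u \<in> set U \<Longrightarrow> l < u" and "\<And>u. u \<in> set D \<Longrightarrow> u < l"
  shows "avoids (U @ D @ [l]) pattern_1_3_2 \<longleftrightarrow>
    avoids U pattern_1_3_2 \<and> avoids D pattern_1_3_2"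
proof -
  have "contains U pattern_1_3_2 \<or> contains D pattern_1_3_2"
    if w: "contains (U @ D @ [l]) pattern_1_3_2"
  proof -
    let ?w = "U @ D @ [l]"
    obtain a b c where abc: "a < b" "b < c" "c < length ?w" "?w ! a < ?w ! c" "?w ! c < ?w ! b"
      using w unfolding contains_132_iff by blast
    have low: "?w ! p \<le> l" if "length U \<le> p" "p < length ?w" for p
    proof -
      have "?w ! p = (D @ [l]) ! (p - length U)" "p - length U < length (D @ [l])"
        using that by (auto simp: nth_append)
      then have "?w ! p \<in> set (D @ [l])"
        by (simp only: nth_mem)
      then show ?thesis
        using assms(2) by (auto intro: less_imp_le)
    qed
    have high: "l < ?w ! p" if "p < length U" for p
      using that assms(1) by (simp add: nth_append)
    consider "c < length U" | "length U \<le> a"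
      using high[of a] low[of c] abc by linarith
    then show ?thesis
    proof cases
      case 1
      then show ?thesis
        using abc unfolding contains_132_iff by (auto simp: nth_append)
    next
      case 2
      have "c \<noteq> length U + length D"
        using low[of b] 2 abc by (auto simp: nth_append)
      then have "a - length U < b - length U" "b - length U < c - length U" "c - length U < length D"
        "D ! (a - length U) < D ! (c - length U)" "D ! (c - length U) < D ! (b - length U)"
        using abc 2 by (auto simp: nth_append split: if_splits)
      then show ?thesis
        unfolding contains_132_iff by blast
    qed
  qed
  then show ?thesis
    using contains_appendI[of U _ "[]" "D @ [l]"] contains_appendI[of D _ U "[l]"] by auto
qed

text \<open>Cut \<open>ys\<close> after its initial run of letters above \<open>l\<close>. The next
  letter, if any, is below \<open>l\<close>; a letter above \<open>l\<close> further on would form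
  1-3-2 with it and the final \<open>l\<close>.\<close>

lemma avoids_132_decompose:
  assumes "avoids (ys @ [l]) pattern_1_3_2" and "l \<notin> set ys"
  obtains U D where "ys = U @ D" "\<And>u. u \<in> set U \<Longrightarrow> l < u" "\<And>u. u \<in> set D \<Longrightarrow> u < l"
proof
  let ?U = "takeWhile (\<lambda>u. l < u) ys" and ?D = "dropWhile (\<lambda>u. l < u) ys"
  show "ys = ?U @ ?D"
    by simp
  show "l < u" if "u \<in> set ?U" for u
    using that by (auto dest: set_takeWhileD)
  show "u < l" if u: "u \<in> set ?D" for u
  proof (rule ccontr)
    assume "\<not> u < l"
    moreover have "u \<noteq> l"
      using that assms(2) by (auto dest: set_dropWhileD)
    ultimately have "l < u"
      by simp
    obtain q where q: "q < length ?D" "?D ! q = u"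
      using u unfolding in_set_conv_nth by blast
    have ys: "(ys @ [l]) ! (length ?U + j) = ?D ! j" if "j < length ?D" for j
    proof -
      have "(?U @ ?D @ [l]) ! (length ?U + j) = ?D ! j"
        using that by (simp only: nth_append_length_plus) (simp add: nth_append)
      then show ?thesis
        by (simp only: append_assoc[symmetric] takeWhile_dropWhile_id)
    qed
    have len: "length ys = length ?U + length ?D"
      by (metis length_append takeWhile_dropWhile_id)
    have "?D \<noteq> []"
      using u by (metis empty_iff empty_set)
    then have "\<not> l < ?D ! 0"
      by (metis hd_conv_nth hd_dropWhile)
    moreover have "?D ! 0 \<noteq> l"
      using \<open>?D \<noteq> []\<close> assms(2) by (metis length_greater_0_conv nth_mem set_dropWhileD)
    ultimately have "?D ! 0 < l"
      by simp
    with \<open>l < u\<close> q have "0 < q"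
      by (cases q) auto
    have "contains (ys @ [l]) pattern_1_3_2"
      unfolding contains_132_iff
    proof (intro exI conjI)
      show "length ?U + 0 < length ?U + q" "length ?U + q < length ys" "length ys < length (ys @ [l])"
        using \<open>0 < q\<close> q len by auto
      show "(ys @ [l]) ! (length ?U + 0) < (ys @ [l]) ! length ys"
        using ys[of 0] \<open>?D \<noteq> []\<close> \<open>?D ! 0 < l\<close> by simp
      show "(ys @ [l]) ! length ys < (ys @ [l]) ! (length ?U + q)"
        using ys[of q] q \<open>l < u\<close> by simp
    qed
    then show False
      using assms(1) by simp
  qed
qed

text \<open>Only \<tau> is tested on the extended word: appended increasing maxima cannot take part
  in a 1-3-2, so testing \<pi> alone for it amounts to the same.\<close>

definition ext_avoiders :: "pattern \<Rightarrow> nat \<Rightarrow> nat \<Rightarrow> nat list set" where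
  "ext_avoiders \<tau> i n = {\<pi> \<in> permutations_of_set {1..n}.
     avoids \<pi> pattern_1_3_2 \<and> avoids (\<pi> @ [n + 1..<n + 1 + i]) \<tau>}"

definition ext_gf :: "pattern \<Rightarrow> nat \<Rightarrow> int fps" where
  "ext_gf \<tau> i = Abs_fps (\<lambda>n. int (card (ext_avoiders \<tau> i n)))"

lemma finite_ext_avoiders: "finite (ext_avoiders \<tau> i n)"
  unfolding ext_avoiders_def by simp

lemma ext_gf_0: "ext_gf \<tau> 0 = avoid_gf \<tau>"
  by (simp add: ext_gf_def avoid_gf_def avoid_count_def ext_avoiders_def)

section \<open>Occurrences of a pattern that ends in an increasing block\<close>

locale block_pattern =
  fixes d k :: nat and \<tau> \<tau>' :: pattern
  assumes d_less_k: "d < k"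
    and pattern': "gen_pattern_on {1..d} \<tau>'"
    and pattern_eq: "\<tau> = dash_append \<tau>' (Pattern [d + 1..<k + 1] {})"
begin

lemma length_letters': "length (letters \<tau>') = d"
  using pattern' unfolding gen_pattern_on_def
  by (auto simp: permutations_of_set_def dest: distinct_card)

lemma letters_eq: "letters \<tau> = letters \<tau>' @ [d + 1..<k + 1]"
  by (simp add: pattern_eq dash_append_def)

lemma dashes_eq: "dashes \<tau> = insert d (dashes \<tau>')"
  by (auto simp: pattern_eq dash_append_def length_letters')

lemma length_letters: "length (letters \<tau>) = k"
  using d_less_k by (simp add: letters_eq length_letters')

lemma nth_letters_low: "j < d \<Longrightarrow> letters \<tau> ! j = letters \<tau>' ! j"
  by (simp add: letters_eq length_letters' nth_append)

lemma nth_letters'_le: "j < d \<Longrightarrow> letters \<tau>' ! j \<le> d"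
  using pattern' nth_mem[of j "letters \<tau>'"] length_letters' unfolding gen_pattern_on_def
  by (auto simp: permutations_of_set_def)

lemma nth_letters_high: "d \<le> j \<Longrightarrow> j < k \<Longrightarrow> letters \<tau> ! j = j + 1"
  by (simp add: letters_eq length_letters' nth_append del: upt_Suc)

lemma block_not_dash: "d < j \<Longrightarrow> j \<notin> dashes \<tau>"
  using pattern' length_letters' by (auto simp: dashes_eq gen_pattern_on_def)

text \<open>The last property says that the block sits on consecutive positions. With 0-based letter
  indices the block starts at \<open>d\<close>, and every dash of \<tau> has number at most
  \<open>d\<close>, so no dash separates two block letters.\<close>

lemma containsE:
  assumes "contains w \<tau>"
  obtains i where "strict_mono_on {..<k} i" "\<And>j. j < k \<Longrightarrow> i j < length w"
    "\<And>a b. a < k \<Longrightarrow> b < k \<Longrightarrow> w ! i a < w ! i b \<longleftrightarrow> letters \<tau> ! a < letters \<tau> ! b"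
    "\<And>j. Suc j < k \<Longrightarrow> Suc j \<notin> dashes \<tau> \<Longrightarrow> i (Suc j) = Suc (i j)"
    "\<And>t. d + t < k \<Longrightarrow> i (d + t) = i d + t"
proof -
  obtain i where i: "strict_mono_on {..<k} i" "\<And>j. j < k \<Longrightarrow> i j < length w"
    "\<And>a b. a < k \<Longrightarrow> b < k \<Longrightarrow> w ! i a < w ! i b \<longleftrightarrow> letters \<tau> ! a < letters \<tau> ! b"
    "\<And>j. Suc j < k \<Longrightarrow> Suc j \<notin> dashes \<tau> \<Longrightarrow> i (Suc j) = Suc (i j)"
    using assms unfolding contains_def length_letters by blast
  have "i (d + t) = i d + t" if "d + t < k" for t
    using that
  proof (induction t)
    case (Suc t)
    then show ?case
      using i(4)[of "d + t"] block_not_dash[of "Suc (d + t)"] by simp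
  qed simp
  with i show ?thesis
    by (rule that)
qed

text \<open>The block needs \<open>k - d\<close> consecutive positions in a word of length
  \<open>n + (k - d)\<close>, so it starts at position \<open>n\<close> at the latest, and the
  letters of \<tau>' before it fall into \<pi>. Conversely, an occurrence of \<tau>' in \<pi> is
  completed by placing the block on the appended maxima, which exceed all of \<pi>.\<close>

lemma contains_ext_block_iff:
  assumes "set \<pi> \<subseteq> {1..n}" and "length \<pi> = n"
  shows "contains (\<pi> @ [n + 1..<n + 1 + (k - d)]) \<tau> \<longleftrightarrow> contains \<pi> \<tau>'"
proof
  let ?w = "\<pi> @ [n + 1..<n + 1 + (k - d)]"
  assume "contains ?w \<tau>"
  then obtain i where i: "strict_mono_on {..<k} i" "\<And>j. j < k \<Longrightarrow> i j < length ?w"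
    "\<And>a b. a < k \<Longrightarrow> b < k \<Longrightarrow> ?w ! i a < ?w ! i b \<longleftrightarrow> letters \<tau> ! a < letters \<tau> ! b"
    "\<And>j. Suc j < k \<Longrightarrow> Suc j \<notin> dashes \<tau> \<Longrightarrow> i (Suc j) = Suc (i j)"
    "\<And>t. d + t < k \<Longrightarrow> i (d + t) = i d + t"
    by (rule containsE) blast
  have "i d \<le> n"
    using i(2)[of "k - 1"] i(5)[of "k - d - 1"] d_less_k assms(2) by (simp del: upt_Suc)
  have less: "i j < n" if "j < d" for j
  proof -
    have "i j < i d"
      using i(1) that d_less_k by (simp add: strict_mono_on_def)
    with \<open>i d \<le> n\<close> show ?thesis
      by simp
  qed
  show "contains \<pi> \<tau>'"
    unfolding contains_def length_letters'
  proof (intro exI[of _ i] conjI allI impI)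
    show "strict_mono_on {..<d} i"
      using i(1) d_less_k by (auto simp: strict_mono_on_def)
    show "i j < length \<pi>" if "j < d" for j
      using less that assms(2) by simp
    show "\<pi> ! i a < \<pi> ! i b \<longleftrightarrow> letters \<tau>' ! a < letters \<tau>' ! b" if "a < d" "b < d" for a b
      using i(3)[of a b] that less assms(2) d_less_k by (simp add: nth_append nth_letters_low)
    show "i (Suc j) = Suc (i j)" if "Suc j < d \<and> Suc j \<notin> dashes \<tau>'" for j
      using i(4)[of j] that d_less_k by (simp add: dashes_eq)
  qed
next
  let ?w = "\<pi> @ [n + 1..<n + 1 + (k - d)]"
  assume "contains \<pi> \<tau>'"
  then obtain i where i: "strict_mono_on {..<d} i" "\<And>j. j < d \<Longrightarrow> i j < n"
    "\<And>a b. a < d \<Longrightarrow> b < d \<Longrightarrow> \<pi> ! i a < \<pi> ! i b \<longleftrightarrow> letters \<tau>' ! a < letters \<tau>' ! b"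
    "\<And>j. Suc j < d \<Longrightarrow> Suc j \<notin> dashes \<tau>' \<Longrightarrow> i (Suc j) = Suc (i j)"
    unfolding contains_def length_letters' assms(2) by blast
  define f where "f j = (if j < d then i j else n + (j - d))" for j
  have low: "?w ! f j = \<pi> ! i j" "\<pi> ! i j \<le> n" if "j < d" for j
  proof -
    show "?w ! f j = \<pi> ! i j"
      using that i(2)[OF that] assms(2) by (simp add: f_def nth_append)
    have "\<pi> ! i j \<in> {1..n}"
      using i(2)[OF that] assms by (intro subsetD[OF assms(1)] nth_mem) simp
    then show "\<pi> ! i j \<le> n"
      by simp
  qed
  have high: "?w ! f j = n + 1 + (j - d)" if "d \<le> j" "j < k" for j
    using that assms(2) by (auto simp: f_def nth_append simp del: upt_Suc)
  show "contains ?w \<tau>"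
    unfolding contains_def length_letters
  proof (intro exI[of _ f] conjI allI impI)
    show "strict_mono_on {..<k} f"
      using i(1) by (auto simp: strict_mono_on_def f_def intro!: trans_less_add1 i(2)
          simp del: add_diff_assoc diff_add_assoc2)
    show "f j < length ?w" if "j < k" for j
      using that i(2) assms(2) by (auto simp: f_def trans_less_add1)
    show "?w ! f a < ?w ! f b \<longleftrightarrow> letters \<tau> ! a < letters \<tau> ! b" if "a < k" "b < k" for a b
    proof (cases "a < d"; cases "b < d")
      assume "a < d" "b < d"
      then show ?thesis
        using i(3) low(1) by (simp add: nth_letters_low)
    next
      assume "a < d" "\<not> b < d"
      then show ?thesis
        using low[of a] high[of b] that nth_letters'_le[of a]
        by (simp add: nth_letters_low nth_letters_high)
    next
      assume "\<not> a < d" "b < d"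
      then show ?thesis
        using low[of b] high[of a] that nth_letters'_le[of b]
        by (simp add: nth_letters_low nth_letters_high)
    next
      assume "\<not> a < d" "\<not> b < d"
      then show ?thesis
        using that by (simp only: high nth_letters_high not_less) arith
    qed
    show "f (Suc j) = Suc (f j)" if "Suc j < k \<and> Suc j \<notin> dashes \<tau>" for j
      using that i(4)[of j] by (auto simp: f_def dashes_eq)
  qed
qed

lemma ext_gf_block: "ext_gf \<tau> (k - d) = avoid_gf \<tau>'"
proof -
  have "ext_avoiders \<tau> (k - d) n =
      {\<pi> \<in> permutations_of_set {1..n}. avoids \<pi> pattern_1_3_2 \<and> avoids \<pi> \<tau>'}" for n
    using contains_ext_block_iff[of _ n] length_finite_permutations_of_set[of _ "{1..n}"]
    unfolding ext_avoiders_def by (auto simp: permutations_of_set_def)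
  then show ?thesis
    by (simp add: ext_gf_def avoid_gf_def avoid_count_def)
qed

text \<open>If the block ends inside \<open>U\<close>, so does the whole occurrence. Otherwise the
  descent from \<open>U\<close> to \<open>D @ [l]\<close> forces the block to start after
  \<open>U\<close>, and the bound on \<open>E\<close> makes it start no later than \<open>l\<close>.
  Its first entry is then at most \<open>l\<close>, and the letters of \<tau>', being smaller still,
  cannot lie in \<open>U\<close>.\<close>

lemma contains_append_iff:
  assumes U: "\<And>u. u \<in> set U \<Longrightarrow> l < u" and D: "\<And>u. u \<in> set D \<Longrightarrow> u < l"
    and E: "length E < k - d"
  shows "contains (U @ D @ [l] @ E) \<tau> \<longleftrightarrow> contains U \<tau> \<or> contains (D @ [l] @ E) \<tau>"
proof
  let ?w = "U @ D @ [l] @ E"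
  assume "contains ?w \<tau>"
  then obtain i where i: "strict_mono_on {..<k} i" "\<And>j. j < k \<Longrightarrow> i j < length ?w"
    "\<And>a b. a < k \<Longrightarrow> b < k \<Longrightarrow> ?w ! i a < ?w ! i b \<longleftrightarrow> letters \<tau> ! a < letters \<tau> ! b"
    "\<And>j. Suc j < k \<Longrightarrow> Suc j \<notin> dashes \<tau> \<Longrightarrow> i (Suc j) = Suc (i j)"
    "\<And>t. d + t < k \<Longrightarrow> i (d + t) = i d + t"
    by (rule containsE) blast
  have high: "l < ?w ! p" if "p < length U" for p
    using that U by (simp add: nth_append)
  have low: "?w ! p \<le> l" if "length U \<le> p" "p \<le> length U + length D" for p
  proof -
    have "?w ! p = (D @ [l]) ! (p - length U)" "p - length U < length (D @ [l])"
      using that by (auto simp: nth_append)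
    then have "?w ! p \<in> set (D @ [l])"
      by (simp only: nth_mem)
    then show ?thesis
      using D by (auto intro: less_imp_le)
  qed
  have last: "i (k - 1) = i d + (k - d - 1)"
    using i(5)[of "k - d - 1"] d_less_k by simp
  show "contains U \<tau> \<or> contains (D @ [l] @ E) \<tau>"
  proof (cases "i (k - 1) < length U")
    case True
    have less: "i j < length U" if "j < k" for j
    proof (cases "j = k - 1")
      case False
      then have "i j < i (k - 1)"
        using i(1) that by (simp add: strict_mono_on_def)
      with True show ?thesis
        by simp
    qed (use True in simp)
    have "contains U \<tau>"
      unfolding contains_def length_letters
    proof (intro exI[of _ i] conjI allI impI)
      show "U ! i a < U ! i b \<longleftrightarrow> letters \<tau> ! a < letters \<tau> ! b" if "a < k" "b < k" for a b
        using i(3)[of a b] less that by (simp add: nth_append)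
    qed (use i(1,4) less in auto)
    then show ?thesis ..
  next
    case False
    have "length U \<le> i d"
    proof (rule ccontr)
      assume *: "\<not> length U \<le> i d"
      \<comment> \<open>If the block crossed the boundary, its letters with indices
        \<open>d + t\<close> and \<open>d + Suc t\<close> would occupy the last position of
        \<open>U\<close> and the one after it, where the word descends.\<close>
      define t where "t = length U - 1 - i d"
      have t: "i d + t = length U - 1" "d + Suc t < k"
        using * False last unfolding t_def by linarith+
      have pos: "i (d + t) = length U - 1" "i (d + Suc t) = length U"
        using i(5)[of t] i(5)[of "Suc t"] t * by auto
      have "?w ! i (d + t) < ?w ! i (d + Suc t)"
        using i(3)[of "d + t" "d + Suc t"] t(2) by (simp add: nth_letters_high)
      moreover have "l < ?w ! i (d + t)"
        using high[of "length U - 1"] pos(1) * by auto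
      moreover have "?w ! i (d + Suc t) \<le> l"
        using low[of "length U"] pos(2) by simp
      ultimately show False
        by simp
    qed
    \<comment> \<open>A block starting after \<open>l\<close> would have to fit into
      \<open>E\<close>, which is too short.\<close>
    moreover have "i d \<le> length U + length D"
      using i(2)[of "k - 1"] last E by simp
    ultimately have "?w ! i d \<le> l"
      by (rule low)
    \<comment> \<open>For \<open>j < d\<close> the argument is by values rather than positions: the
      entry is smaller than the first block entry, hence below \<open>l\<close>, while
      \<open>U\<close> lies above \<open>l\<close>.\<close>
    have ge: "length U \<le> i j" if "j < k" for j
    proof (cases "j < d")
      case True
      then have "?w ! i j < ?w ! i d"
        using i(3)[of j d] d_less_k nth_letters'_le[of j]
        by (simp add: nth_letters_low nth_letters_high)
      with \<open>?w ! i d \<le> l\<close> show ?thesis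
        using high[of "i j"] by linarith
    next
      case False
      then show ?thesis
        using i(5)[of "j - d"] that \<open>length U \<le> i d\<close> by simp
    qed
    have "contains (D @ [l] @ E) \<tau>"
      unfolding contains_def length_letters
    proof (intro exI[of _ "\<lambda>j. i j - length U"] conjI allI impI)
      show "strict_mono_on {..<k} (\<lambda>j. i j - length U)"
        using i(1) ge by (auto simp: strict_mono_on_def diff_less_mono)
      show "i j - length U < length (D @ [l] @ E)" if "j < k" for j
        using i(2)[OF that] ge[OF that] by simp
      have "?w ! i j = (D @ [l] @ E) ! (i j - length U)" if "j < k" for j
        using ge[OF that] nth_append_right[of U "i j" "D @ [l] @ E"] by simp
      then show "(D @ [l] @ E) ! (i a - length U) < (D @ [l] @ E) ! (i b - length U) \<longleftrightarrow>
          letters \<tau> ! a < letters \<tau> ! b" if "a < k" "b < k" for a b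
        using i(3)[of a b] that by simp
      show "i (Suc j) - length U = Suc (i j - length U)" if "Suc j < k \<and> Suc j \<notin> dashes \<tau>" for j
        using i(4)[of j] ge[of j] that by (simp add: Suc_diff_le)
    qed
    then show ?thesis ..
  qed
next
  assume "contains U \<tau> \<or> contains (D @ [l] @ E) \<tau>"
  then show "contains (U @ D @ [l] @ E) \<tau>"
    using contains_appendI[of U \<tau> "[]" "D @ [l] @ E"] contains_appendI[of "D @ [l] @ E" \<tau> U "[]"]
    by auto
qed

section \<open>The decomposition at the last letter as a bijection\<close>

definition glue :: "nat \<Rightarrow> nat list \<Rightarrow> nat list \<Rightarrow> nat list" where
  "glue a U D = map ((+) (Suc a)) U @ D @ [Suc a]"

text \<open>The last letter \<open>Suc a\<close> of the glued word exceeds all of \<open>D\<close>,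
  so together with the \<open>i\<close> appended maxima it acts as \<open>Suc i\<close> maxima
  following \<open>D\<close>. The part \<open>U\<close> is tested without any extension, whence the
  index 0.\<close>

lemma glue_mem_iff:
  assumes U: "U \<in> permutations_of_set {1..n - a}" and D: "D \<in> permutations_of_set {1..a}"
    and a: "a \<le> n" and i: "i < k - d"
  shows "glue a U D \<in> ext_avoiders \<tau> i (Suc n) \<longleftrightarrow>
    U \<in> ext_avoiders \<tau> 0 (n - a) \<and> D \<in> ext_avoiders \<tau> (Suc i) a"
proof -
  have sets: "set U = {1..n - a}" "distinct U" "set D = {1..a}" "distinct D"
    using U D by (auto simp: permutations_of_set_def)
  have "(+) (Suc a) ` {1..n - a} = {a + 2..Suc n}"
    using a by (simp only: image_add_atLeastAtMost) simp
  then have U': "set (map ((+) (Suc a)) U) = {a + 2..Suc n}"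
    using sets by simp
  have perm: "glue a U D \<in> permutations_of_set {1..Suc n}"
    unfolding permutations_of_set_def glue_def
    using sets U' a by (auto simp: distinct_map simp del: set_map)
  have above: "\<And>u. u \<in> set (map ((+) (Suc a)) U) \<Longrightarrow> Suc a < u"
    unfolding U' by auto
  have below: "\<And>u. u \<in> set D \<Longrightarrow> u < Suc a"
    using sets by auto
  have shift: "contains (map ((+) (Suc a)) U) \<sigma> \<longleftrightarrow> contains U \<sigma>" for \<sigma>
    by (rule contains_map_iff) (auto simp: strict_mono_on_def)
  \<comment> \<open>This relabelling opens a gap above \<open>Suc a\<close> for the
    \<open>n - a\<close> values of \<open>U\<close>: it carries the maxima following
    \<open>Suc a\<close> in the extension of \<open>D\<close> to those that follow the glued
    word.\<close>
  define f where "f x = (if x \<le> Suc a then x else x + (n - a))" for x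
  have "map f D = D"
    using sets by (intro map_idI) (auto simp: f_def)
  moreover have "map f [a + 1..<a + 1 + Suc i] = Suc a # [Suc n + 1..<Suc n + 1 + i]"
    using a by (intro nth_equalityI) (auto simp: f_def nth_Cons simp del: upt_Suc split: nat.split)
  ultimately have "map f (D @ [a + 1..<a + 1 + Suc i]) = D @ [Suc a] @ [Suc n + 1..<Suc n + 1 + i]"
    by (simp del: upt_Suc)
  moreover have "strict_mono_on (set (D @ [a + 1..<a + 1 + Suc i])) f"
    by (auto simp: strict_mono_on_def f_def)
  ultimately have ext: "contains (D @ [Suc a] @ [Suc n + 1..<Suc n + 1 + i]) \<tau> \<longleftrightarrow>
      contains (D @ [a + 1..<a + 1 + Suc i]) \<tau>"
    by (metis contains_map_iff)
  have "avoids (glue a U D) pattern_1_3_2 \<longleftrightarrow> avoids U pattern_1_3_2 \<and> avoids D pattern_1_3_2"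
    unfolding glue_def shift[of pattern_1_3_2, symmetric]
    by (intro avoids_132_append_iff above below)
  moreover have "contains (glue a U D @ [Suc n + 1..<Suc n + 1 + i]) \<tau> \<longleftrightarrow>
      contains U \<tau> \<or> contains (D @ [a + 1..<a + 1 + Suc i]) \<tau>"
    unfolding glue_def append_assoc ext[symmetric] shift[of \<tau>, symmetric]
    by (intro contains_append_iff above below) (use i in \<open>simp_all del: upt_Suc\<close>)
  ultimately show ?thesis
    using perm U D unfolding ext_avoiders_def by (auto simp del: upt_Suc)
qed

text \<open>The last letter of a glued word determines \<open>a\<close>, and then the length
  \<open>n - a\<close> of \<open>U\<close> determines where to cut; this gives injectivity.
  Surjectivity is the splitting of a 1-3-2 avoider at its last letter, with \<open>U\<close> reduced
  to a permutation of an initial interval.\<close>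

lemma ext_avoiders_Suc:
  assumes i: "i < k - d"
  shows "bij_betw (\<lambda>(a, U, D). glue a U D)
    (SIGMA a:{0..n}. ext_avoiders \<tau> 0 (n - a) \<times> ext_avoiders \<tau> (Suc i) a)
    (ext_avoiders \<tau> i (Suc n))"
  unfolding bij_betw_def
proof
  show "inj_on (\<lambda>(a, U, D). glue a U D)
    (SIGMA a:{0..n}. ext_avoiders \<tau> 0 (n - a) \<times> ext_avoiders \<tau> (Suc i) a)" (is "inj_on ?g ?S")
  proof (rule inj_onI)
    fix p q
    assume "p \<in> ?S" "q \<in> ?S" and pq: "?g p = ?g q"
    then obtain a U D a' U' D' where p: "p = (a, U, D)" and q: "q = (a', U', D')"
      and mem: "U \<in> ext_avoiders \<tau> 0 (n - a)" "U' \<in> ext_avoiders \<tau> 0 (n - a')"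
      by auto
    have eq: "glue a U D = glue a' U' D'"
      using pq by (simp add: p q)
    from eq have "last (glue a U D) = last (glue a' U' D')"
      by simp
    then have "a = a'"
      by (simp add: glue_def)
    moreover from this have "length U = length U'"
      using mem by (auto simp: ext_avoiders_def dest!: length_finite_permutations_of_set)
    ultimately show "p = q"
      using eq by (auto simp: p q glue_def inj_map_eq_map)
  qed
  show "(\<lambda>(a, U, D). glue a U D) `
      (SIGMA a:{0..n}. ext_avoiders \<tau> 0 (n - a) \<times> ext_avoiders \<tau> (Suc i) a) = ext_avoiders \<tau> i (Suc n)"
  proof (intro equalityI subsetI)
    fix w
    assume "w \<in> (\<lambda>(a, U, D). glue a U D) `
      (SIGMA a:{0..n}. ext_avoiders \<tau> 0 (n - a) \<times> ext_avoiders \<tau> (Suc i) a)"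
    then obtain a U D where w: "w = glue a U D" "a \<le> n" "U \<in> ext_avoiders \<tau> 0 (n - a)"
      "D \<in> ext_avoiders \<tau> (Suc i) a"
      by auto
    then have "U \<in> permutations_of_set {1..n - a}" "D \<in> permutations_of_set {1..a}"
      by (simp_all add: ext_avoiders_def)
    from glue_mem_iff[OF this w(2) i] w show "w \<in> ext_avoiders \<tau> i (Suc n)"
      by simp
  next
    fix w
    assume w: "w \<in> ext_avoiders \<tau> i (Suc n)"
    then have perm: "set w = {1..Suc n}" "distinct w" and av: "avoids w pattern_1_3_2"
      by (auto simp: ext_avoiders_def permutations_of_set_def)
    then obtain ys l where ys: "w = ys @ [l]"
      by (cases w rule: rev_cases) auto
    then have l: "l \<notin> set ys" "l \<in> {1..Suc n}"
      using perm by auto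
    obtain U D where UD: "ys = U @ D" "\<And>u. u \<in> set U \<Longrightarrow> l < u" "\<And>u. u \<in> set D \<Longrightarrow> u < l"
      using avoids_132_decompose av l(1) unfolding ys by blast
    define a where "a = l - 1"
    have a: "l = Suc a" "a \<le> n"
      using l(2) by (auto simp: a_def)
    have union: "set U \<union> set D \<union> {l} = {1..Suc n}"
      using perm(1) by (auto simp: ys UD(1))
    \<comment> \<open>The letters of \<open>w\<close> fill an interval and \<open>l\<close>
      separates the values of \<open>D\<close> from those of \<open>U\<close>, so each part fills an
      interval too.\<close>
    have setD: "set D = {1..a}"
    proof (intro equalityI subsetI)
      fix x assume "x \<in> set D"
      then show "x \<in> {1..a}"
        using UD(3)[of x] union a by auto
    next
      fix x assume "x \<in> {1..a}"
      then have "x \<in> set U \<union> set D \<union> {l}" "x < l"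
        unfolding union using a by auto
      then show "x \<in> set D"
        using UD(2)[of x] by auto
    qed
    have setU: "set U = {a + 2..Suc n}"
    proof (intro equalityI subsetI)
      fix x assume "x \<in> set U"
      then show "x \<in> {a + 2..Suc n}"
        using UD(2)[of x] union a by auto
    next
      fix x assume "x \<in> {a + 2..Suc n}"
      then have "x \<in> set U \<union> set D \<union> {l}" "l < x"
        unfolding union using a by auto
      then show "x \<in> set U"
        using UD(3)[of x] by auto
    qed
    \<comment> \<open>The truncated subtraction is invertible here because every entry of
      \<open>U\<close> exceeds \<open>Suc a\<close>.\<close>
    define U0 where "U0 = map (\<lambda>x. x - Suc a) U"
    have U: "U = map ((+) (Suc a)) U0"
      unfolding U0_def map_map by (rule map_idI[symmetric]) (auto simp: setU)
    have "(+) (Suc a) ` {1..n - a} = {a + 2..Suc n}"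
      using a by (simp only: image_add_atLeastAtMost) simp
    then have "(+) (Suc a) ` set U0 = (+) (Suc a) ` {1..n - a}"
      using setU U by (metis list.set_map)
    then have "set U0 = {1..n - a}"
      by (simp only: inj_image_eq_iff[OF inj_on_add])
    moreover have "distinct U0" "distinct D"
      using perm(2) unfolding ys UD(1) U by (auto simp: distinct_map)
    ultimately have perms: "U0 \<in> permutations_of_set {1..n - a}" "D \<in> permutations_of_set {1..a}"
      using setD by (auto simp: permutations_of_set_def)
    have "w = glue a U0 D"
      using ys UD(1) U a by (simp add: glue_def)
    with glue_mem_iff[OF perms a(2) i] w a(2)
    show "w \<in> (\<lambda>(a, U, D). glue a U D) `
      (SIGMA a:{0..n}. ext_avoiders \<tau> 0 (n - a) \<times> ext_avoiders \<tau> (Suc i) a)"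
      by (intro image_eqI[of _ _ "(a, U0, D)"]) auto
  qed
qed

section \<open>The recurrence for the generating functions and its iteration\<close>

lemma card_ext_avoiders_0:
  assumes "i < k - d"
  shows "card (ext_avoiders \<tau> i 0) = 1"
proof -
  have "avoids [] pattern_1_3_2"
    by (simp add: contains_132_iff)
  \<comment> \<open>The word has \<open>i\<close> letters, fewer than the \<open>k - d\<close>
    consecutive positions that the final block needs.\<close>
  moreover have "avoids [1..<1 + i] \<tau>"
  proof
    assume "contains [1..<1 + i] \<tau>"
    then obtain j where "\<And>t. t < k \<Longrightarrow> j t < length [1..<1 + i]"
      "\<And>t. d + t < k \<Longrightarrow> j (d + t) = j d + t"
      by (rule containsE) blast
    from this(1)[of "k - 1"] this(2)[of "k - d - 1"] show False
      using assms d_less_k by (simp del: upt_Suc)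
  qed
  ultimately have "ext_avoiders \<tau> i 0 = {[]}"
    by (auto simp: ext_avoiders_def)
  then show ?thesis
    by simp
qed

text \<open>The constant term 1 counts the empty permutation. In higher degrees the gluing bijection
  becomes a convolution, and \<open>fps_X\<close> accounts for the last letter, which belongs to
  neither part.\<close>

lemma ext_gf_step:
  assumes "i < k - d"
  shows "ext_gf \<tau> i = 1 + fps_X * avoid_gf \<tau> * ext_gf \<tau> (Suc i)"
proof (rule fps_ext)
  fix n
  show "fps_nth (ext_gf \<tau> i) n = fps_nth (1 + fps_X * avoid_gf \<tau> * ext_gf \<tau> (Suc i)) n"
  proof (cases n)
    case 0
    then show ?thesis
      using card_ext_avoiders_0[OF assms] by (simp add: ext_gf_def)
  next
    case (Suc n)
    have "card (ext_avoiders \<tau> i (Suc n)) =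
        (\<Sum>a=0..n. card (ext_avoiders \<tau> (Suc i) a) * card (ext_avoiders \<tau> 0 (n - a)))"
      using bij_betw_same_card[OF ext_avoiders_Suc[OF assms, of n]]
      by (simp add: card_cartesian_product finite_ext_avoiders mult.commute)
    then have "fps_nth (ext_gf \<tau> i) (Suc n) = fps_nth (ext_gf \<tau> (Suc i) * ext_gf \<tau> 0) n"
      by (simp add: ext_gf_def fps_mult_nth)
    then show ?thesis
      unfolding Suc ext_gf_0 by (simp add: mult.assoc mult.commute)
  qed
qed

text \<open>Unfolding the recurrence \<open>i\<close> times adds one power of
  \<open>fps_X * avoid_gf \<tau>\<close> per step. At \<open>i = k - d\<close> the remaining factor
  is \<open>avoid_gf \<tau>'\<close> by \<open>ext_gf_block\<close>.\<close>

lemma avoid_gf_expand: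
  assumes "i \<le> k - d"
  shows "avoid_gf \<tau> = (\<Sum>j<i. (fps_X * avoid_gf \<tau>) ^ j) + (fps_X * avoid_gf \<tau>) ^ i * ext_gf \<tau> i"
  using assms
proof (induction i)
  case 0
  then show ?case
    by (simp add: ext_gf_0)
next
  case (Suc i)
  let ?y = "fps_X * avoid_gf \<tau>"
  have "avoid_gf \<tau> = (\<Sum>j<i. ?y ^ j) + ?y ^ i * ext_gf \<tau> i"
    using Suc by simp
  also have "ext_gf \<tau> i = 1 + ?y * ext_gf \<tau> (Suc i)"
    using ext_gf_step[of i] Suc.prems by simp
  finally show ?case
    by (simp add: algebra_simps)
qed

end

theorem theorem2p7:
  fixes d k :: nat and \<tau> \<tau>' :: pattern
  assumes "1 \<le> d" and "d < k"
    and "gen_pattern_on {1..d} \<tau>'"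
    and "\<tau> = dash_append \<tau>' (Pattern [d + 1..<k + 1] {})"
  shows "avoid_gf \<tau> =
    (\<Sum>j = 0..k - d - 1. (fps_X * avoid_gf \<tau>) ^ j)
      + fps_X ^ (k - d) * avoid_gf \<tau> ^ (k - d) * avoid_gf \<tau>'"
proof -
  interpret block_pattern d k \<tau> \<tau>'
    using assms(2-4) by unfold_locales
  \<comment> \<open>The two ranges agree because \<open>k - d\<close> is positive; for
    \<open>k - d = 0\<close> truncated subtraction would leave the index 0 in the first.\<close>
  have "{0..k - d - 1} = {..<k - d}"
    using assms(2) by auto
  then show ?thesis
    using avoid_gf_expand[of "k - d"] by (simp add: ext_gf_block power_mult_distrib)
qed

end
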